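(* If $(X,\mathcal{T}_1,\ldots,\mathcal{T}_l)$ is a minimal rational dynamical system, then every point $x\in X$ is uniformly rational recurrent for $(X,\mathcal{T}_1,\ldots,\mathcal{T}_l)$.
   Context: Notation: $\mathbb{N}=\{1,2,\ldots\}$, $\mathbb{Z}^\ast=\mathbb{Z}\setminus\{0\}$; $l\in\mathbb{N}$. Expansion of rationals: every rational number $q$ has a unique expression $q=\sum_{s=1}^{\infty}q_{-s}\frac{(-1)^{s}}{(s+1)!}+\sum_{r=1}^{\infty}q_{r}(-1)^{r+1}r!$ with integers $0\leq q_{-s}\leq s$ for $s\geq 1$ and $0\leq q_r\leq r$ for $r\geq 1$, all but finitely many of which are zero. Put $dom(q)=\{t\in\mathbb{Z}^\ast: q_t\neq 0\}$. Rational indexed family: given a family $\{T_n\}_{n\in\mathbb{Z}^\ast}$ of pairwise commuting continuous maps $X\to X$, for a non-zero rational $q$ with $dom(q)=\{t_1<\ldots<t_m\}$ put $\mathcal{T}^q(x)=T_{t_1}^{q_{t_1}}\cdots T_{t_m}^{q_{t_m}}(x)$, and put $\mathcal{T}^0(x)=x$. Then $\mathcal{T}=(\mathcal{T}^q)_{q\in\mathbb{Q}}$ is the rational indexed family defined from $\{T_n\}_{n\in\mathbb{Z}^\ast}$. Rational dynamical system: $(X,\mathcal{T}_1,\ldots,\mathcal{T}_l)$ where $X$ is a compact metric space and, for $1\leq i\leq l$, $\mathcal{T}_i$ is the rational indexed family defined from a family $\{T_{i,n}\}_{n\in\mathbb{Z}^\ast}$ of homeomorphisms of $X$ onto itself,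 such that $T_{i,n_1}T_{j,n_2}=T_{j,n_2}T_{i,n_1}$ for all $1\leq i,j\leq l$ and $n_1,n_2\in\mathbb{Z}^\ast$. It is minimal if every closed $Y\subseteq X$ with $T_{i,n}(Y)=Y$ for all $1\leq i\leq l$, $n\in\mathbb{Z}^\ast$ satisfies $Y=X$ or $Y=\emptyset$. Syndetic: a subset $E$ of an abelian (semi)group $(G,+)$ is syndetic if there is a non-empty finite $F\subseteq G$ with $G=\bigcup_{g\in F}\{s\in G: g+s\in E\}$. Uniformly rational recurrent: let $G$ be the (abelian) group, under composition, of homeomorphisms of $X$ generated by all $T_{i,n}$, $n\in\mathbb{Z}^\ast$, $1\leq i\leq l$. A point $x\in X$ is uniformly rational recurrent for $(X,\mathcal{T}_1,\ldots,\mathcal{T}_l)$ if for every neighborhood $V$ of $x$ the set $\{S\in G: S(x)\in V\}$ is syndetic in $G$. *)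

theory Defs
  imports "HOL-Analysis.Analysis" "HOL-Algebra.Bij" "HOL-Algebra.Elementary_Groups"
begin

text \<open>The sums run over the nonzero digits only, which makes them finite sums; \<open>d 0\<close>
  is not a digit and is normalised to \<open>0\<close> so that the digit function is unique.\<close>

definition is_digit_expansion :: "(int \<Rightarrow> nat) \<Rightarrow> rat \<Rightarrow> bool" where
  "is_digit_expansion d q \<longleftrightarrow>
     d 0 = 0 \<and> finite {t. d t \<noteq> 0} \<and>
     (\<forall>s\<ge>1. d (- int s) \<le> s) \<and> (\<forall>r\<ge>1. d (int r) \<le> r) \<and>
     q = (\<Sum>s | 1 \<le> s \<and> d (- int s) \<noteq> 0. of_nat (d (- int s)) * ((- 1) ^ s / fact (s + 1)))
       + (\<Sum>r | 1 \<le> r \<and> d (int r) \<noteq> 0. of_nat (d (int r)) * ((- 1) ^ (r + 1) * fact r))"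

definition rat_digit :: "rat \<Rightarrow> int \<Rightarrow> nat" where
  "rat_digit q = (THE d. is_digit_expansion d q)"

definition rat_dom :: "rat \<Rightarrow> int set" where
  "rat_dom q = {t. t \<noteq> 0 \<and> rat_digit q t \<noteq> 0}"

text \<open>For \<open>rat_dom q = {t\<^sub>1 < \<dots> < t\<^sub>m}\<close> this is
  \<open>(T t\<^sub>1 ^^ q\<^sub>1) \<circ> \<dots> \<circ> (T t\<^sub>m ^^ q\<^sub>m)\<close>, where \<open>q\<^sub>j\<close> is the digit of \<open>q\<close> at \<open>t\<^sub>j\<close>;
  for \<open>q = 0\<close> it is the identity.\<close>

definition rational_family :: "(int \<Rightarrow> 'a \<Rightarrow> 'a) \<Rightarrow> rat \<Rightarrow> 'a \<Rightarrow> 'a" where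
  "rational_family T q =
     (if q = 0 then id
      else foldr (\<lambda>t f. (T t ^^ rat_digit q t) \<circ> f) (sorted_list_of_set (rat_dom q)) id)"

text \<open>\<open>TT i\<close> is the rational indexed family defined from \<open>(T i n)\<close>, \<open>n \<noteq> 0\<close>. The space is a
  carrier set \<open>X\<close> with the induced metric, so maps matter only through their values on \<open>X\<close>,
  and \<open>T i n\<close> matters only for \<open>1 \<le> i \<le> l\<close> and \<open>n \<noteq> 0\<close>.\<close>

definition rational_dynamical_system ::
  "'a::metric_space set \<Rightarrow> nat \<Rightarrow> (nat \<Rightarrow> int \<Rightarrow> 'a \<Rightarrow> 'a) \<Rightarrow> (nat \<Rightarrow> rat \<Rightarrow> 'a \<Rightarrow> 'a) \<Rightarrow> bool"
where
  "rational_dynamical_system X l T TT \<longleftrightarrow>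
     compact X \<and> 1 \<le> l \<and>
     (\<forall>i\<in>{1..l}. \<forall>n. n \<noteq> 0 \<longrightarrow> (\<exists>g. homeomorphism X X (T i n) g)) \<and>
     (\<forall>i\<in>{1..l}. \<forall>j\<in>{1..l}. \<forall>m n. m \<noteq> 0 \<longrightarrow> n \<noteq> 0 \<longrightarrow>
        (\<forall>x\<in>X. T i m (T j n x) = T j n (T i m x))) \<and>
     (\<forall>i\<in>{1..l}. \<forall>q. \<forall>x\<in>X. TT i q x = rational_family (T i) q x)"

definition minimal_system ::
  "'a::metric_space set \<Rightarrow> nat \<Rightarrow> (nat \<Rightarrow> int \<Rightarrow> 'a \<Rightarrow> 'a) \<Rightarrow> bool"
where
  "minimal_system X l T \<longleftrightarrow>
     (\<forall>Y. closedin (top_of_set X) Y \<longrightarrow>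
        (\<forall>i\<in>{1..l}. \<forall>n. n \<noteq> 0 \<longrightarrow> T i n ` Y = Y) \<longrightarrow> Y = X \<or> Y = {})"

text \<open>The group or semigroup \<open>G\<close> is written multiplicatively.\<close>

definition syndetic :: "('g, 'b) monoid_scheme \<Rightarrow> 'g set \<Rightarrow> bool" where
  "syndetic G E \<longleftrightarrow>
     E \<subseteq> carrier G \<and>
     (\<exists>F. finite F \<and> F \<noteq> {} \<and> F \<subseteq> carrier G \<and>
        carrier G = (\<Union>g\<in>F. {s \<in> carrier G. g \<otimes>\<^bsub>G\<^esub> s \<in> E}))"

text \<open>Elements of \<open>BijGroup X\<close> are bijections of \<open>X\<close> that are \<open>undefined\<close> outside \<open>X\<close>, hence the
  restriction; all members of the generated subgroup are homeomorphisms of \<open>X\<close>.\<close>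

definition homeo_group ::
  "'a set \<Rightarrow> nat \<Rightarrow> (nat \<Rightarrow> int \<Rightarrow> 'a \<Rightarrow> 'a) \<Rightarrow> ('a \<Rightarrow> 'a) monoid"
where
  "homeo_group X l T =
     subgroup_generated (BijGroup X) {restrict (T i n) X | i n. i \<in> {1..l} \<and> n \<noteq> 0}"

definition uniformly_rational_recurrent ::
  "'a::metric_space set \<Rightarrow> nat \<Rightarrow> (nat \<Rightarrow> int \<Rightarrow> 'a \<Rightarrow> 'a) \<Rightarrow> 'a \<Rightarrow> bool"
where
  "uniformly_rational_recurrent X l T x \<longleftrightarrow>
     (\<forall>V\<subseteq>X. (\<exists>U. openin (top_of_set X) U \<and> x \<in> U \<and> U \<subseteq> V) \<longrightarrow>
        syndetic (homeo_group X l T) {S \<in> carrier (homeo_group X l T). S x \<in> V})"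

end

theory Submission imports Defs begin

text \<open>The translates of an open neighbourhood \<open>U\<close> of \<open>x\<close> by the group cover \<open>X\<close>, because the
  complement of their union is closed, invariant and misses \<open>x\<close>. Finitely many \<open>g\<^sup>-\<^sup>1(U)\<close> cover
  the compact \<open>X\<close>, and these \<open>g\<close> witness syndeticity: \<open>S x\<close> lies in some \<open>g\<^sup>-\<^sup>1(U)\<close>.\<close>

text \<open>Continuity passes from the generators to products and inverses by induction over
  \<open>generate\<close>. This makes preimages of open sets under arbitrary group elements open,
  which the compactness argument needs.\<close>

lemma generate_BijGroup_continuous:
  assumes homeo: "\<And>f. f \<in> A \<Longrightarrow> \<exists>g. homeomorphism X X f g"
    and A: "A \<subseteq> Bij X"
    and "h \<in> generate (BijGroup X) A"
  shows "continuous_on X h"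
  using assms(3)
proof induction
  case one
  then show ?case
    by (auto simp: BijGroup_def)
next
  case (incl f)
  then show ?case
    using homeo homeomorphism_cont1 by blast
next
  case (inv f)
  obtain g where g: "homeomorphism X X f g"
    using homeo inv by blast
  have "inj_on f X"
    using A inv by (auto simp: Bij_def bij_betw_def)
  \<comment> \<open>The left side is the inverse of \<open>f\<close> in \<open>BijGroup X\<close>;
    agreeing on \<open>X\<close> with the continuous inverse \<open>g\<close>, it inherits
    continuity.\<close>
  then have "restrict (inv_into X f) X y = g y" if "y \<in> X" for y
    using g that by (metis homeomorphism_def imageI inv_into_f_eq restrict_apply')
  then have "continuous_on X (restrict (inv_into X f) X)"
    using g by (metis continuous_on_cong homeomorphism_cont2)
  then show ?case
    using A inv by (auto simp: inv_BijGroup)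
next
  case (eng f g)
  have "generate (BijGroup X) A \<subseteq> Bij X"
    using group.generate_incl[OF group_BijGroup, of A X] A by (simp add: BijGroup_def)
  then have fg: "f \<in> Bij X" "g \<in> Bij X"
    using eng by auto
  then have "g ` X = X"
    by (auto simp: Bij_def bij_betw_def)
  then have "continuous_on X (f \<circ> g)"
    using eng by (intro continuous_on_compose) simp_all
  moreover have "continuous_on X (compose X f g) = continuous_on X (f \<circ> g)"
    by (rule continuous_on_cong) (auto simp: compose_def)
  ultimately show ?case
    using fg by (simp add: BijGroup_def)
qed

theorem theorem2p10:
  fixes X :: "'a::metric_space set"
    and l :: nat
    and T :: "nat \<Rightarrow> int \<Rightarrow> 'a \<Rightarrow> 'a"
    and TT :: "nat \<Rightarrow> rat \<Rightarrow> 'a \<Rightarrow> 'a"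
  assumes "rational_dynamical_system X l T TT"
    and "minimal_system X l T"
  shows "\<forall>x\<in>X. uniformly_rational_recurrent X l T x"
proof
  fix x assume x: "x \<in> X"
  define A where "A = {restrict (T i n) X | i n. i \<in> {1..l} \<and> n \<noteq> 0}"
  define H where "H = homeo_group X l T"
  have homeo: "\<exists>g. homeomorphism X X f g" if f: "f \<in> A" for f
  proof -
    obtain i n where in': "f = restrict (T i n) X" "i \<in> {1..l}" "n \<noteq> 0"
      using f A_def by auto
    then obtain g where "homeomorphism X X (T i n) g"
      using assms(1) unfolding rational_dynamical_system_def by blast
    then have "homeomorphism X X f g"
      by (rule homeomorphism_cong) (auto simp: in')
    then show ?thesis
      by blast
  qed
  have A: "A \<subseteq> Bij X"
  proof
    fix f assume f: "f \<in> A"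
    then obtain g where g: "homeomorphism X X f g"
      using homeo by blast
    then have "bij_betw f X X"
      unfolding bij_betw_def homeomorphism_def by (metis inj_on_inverseI)
    then show "f \<in> Bij X"
      using f by (auto simp: Bij_def A_def)
  qed
  interpret B: group "BijGroup X"
    by (rule group_BijGroup)
  interpret H: group H
    by (simp add: H_def homeo_group_def)
  have carrier_H: "carrier H = generate (BijGroup X) A"
  proof -
    \<comment> \<open>\<open>subgroup_generated\<close> first intersects the generators with the
      carrier; since \<open>A \<subseteq> Bij X\<close>, this leaves \<open>A\<close>
      unchanged.\<close>
    have "carrier H = generate (BijGroup X) (carrier (BijGroup X) \<inter> A)"
      unfolding H_def homeo_group_def A_def[symmetric] by (rule carrier_subgroup_generated)
    then show ?thesis
      using A by (simp add: BijGroup_def Int_absorb1)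
  qed
  then have A_H: "A \<subseteq> carrier H"
    by (auto intro: generate.incl)
  have H_Bij: "carrier H \<subseteq> Bij X"
    using A B.generate_incl[of A] by (simp add: carrier_H BijGroup_def)
  have H_closed: "g y \<in> X" if "g \<in> carrier H" "y \<in> X" for g y
    using H_Bij that by (auto simp: Bij_def bij_betw_def)
  have mult_H: "(g \<otimes>\<^bsub>H\<^esub> h) y = g (h y)"
    if "g \<in> carrier H" "h \<in> carrier H" "y \<in> X" for g h y
  proof -
    have "g \<in> Bij X" "h \<in> Bij X"
      using H_Bij that by auto
    then show ?thesis
      using that by (simp add: H_def homeo_group_def BijGroup_def compose_def)
  qed
  have one_H: "\<one>\<^bsub>H\<^esub> y = y" if "y \<in> X" for y
    using that by (simp add: H_def homeo_group_def BijGroup_def)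
  show "uniformly_rational_recurrent X l T x"
    unfolding uniformly_rational_recurrent_def
  proof (intro allI impI)
    fix V assume "V \<subseteq> X" and "\<exists>U. openin (top_of_set X) U \<and> x \<in> U \<and> U \<subseteq> V"
    then obtain U where U: "openin (top_of_set X) U" "x \<in> U" "U \<subseteq> V"
      by blast
    \<comment> \<open>\<open>P g\<close> is the preimage of \<open>U\<close> under \<open>g\<close>.
      The intersection with \<open>X\<close> matters because \<open>g\<close> is
      \<open>undefined\<close> outside \<open>X\<close>, and that value could lie in
      \<open>U\<close>.\<close>
    define P where "P = (\<lambda>g. X \<inter> g -` U)"
    have open_P: "openin (top_of_set X) (P g)" if "g \<in> carrier H" for g
      unfolding P_def
    proof (rule continuous_openin_preimage[OF _ _ U(1)])
      show "continuous_on X g"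
        using generate_BijGroup_continuous[OF homeo A] that carrier_H by blast
      show "g \<in> X \<rightarrow> X"
        using H_closed that by blast
    qed
    define Y where "Y = X - (\<Union>g\<in>carrier H. P g)"
    \<comment> \<open>\<open>Y\<close> consists of the points whose whole orbit avoids
      \<open>U\<close>. Invariance follows since the orbit of \<open>h y\<close> lies in that of
      \<open>y\<close>.\<close>
    have mem_Y: "y \<in> Y \<longleftrightarrow> y \<in> X \<and> (\<forall>g\<in>carrier H. g y \<notin> U)" for y
      by (auto simp: Y_def P_def)
    have maps_Y: "h y \<in> Y" if h: "h \<in> carrier H" and y: "y \<in> Y" for h y
    proof -
      have "g (h y) \<notin> U" if g: "g \<in> carrier H" for g
        using mult_H[OF g h] H.m_closed[OF g h] y by (metis mem_Y)
      then show ?thesis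
        using H_closed h y by (simp add: mem_Y)
    qed
    have "T i n ` Y = Y" if "i \<in> {1..l}" "n \<noteq> 0" for i n
    proof -
      let ?h = "restrict (T i n) X"
      have h: "?h \<in> carrier H"
        using A_H that by (auto simp: A_def)
      have "y \<in> ?h ` Y" if "y \<in> Y" for y
      proof
        have "y \<in> X"
          using that by (simp add: Y_def)
        then show "y = ?h ((inv\<^bsub>H\<^esub> ?h) y)"
          using mult_H[OF h H.inv_closed[OF h], of y] one_H[of y] H.r_inv[OF h] by simp
        show "(inv\<^bsub>H\<^esub> ?h) y \<in> Y"
          using maps_Y[OF H.inv_closed[OF h] that] .
      qed
      then have "?h ` Y = Y"
        using maps_Y[OF h] by blast
      moreover have "?h ` Y = T i n ` Y"
        by (rule image_cong) (auto simp: Y_def)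
      ultimately show ?thesis
        by simp
    qed
    moreover have "closedin (top_of_set X) Y"
    proof -
      have "openin (top_of_set X) (\<Union>g\<in>carrier H. P g)"
        using open_P by (intro openin_Union) auto
      then show ?thesis
        unfolding Y_def by (intro closedin_diff) simp_all
    qed
    ultimately have "Y = X \<or> Y = {}"
      using assms(2)[unfolded minimal_system_def, rule_format, of Y] by simp
    \<comment> \<open>The identity already sends \<open>x\<close> into \<open>U\<close>. This rules
      out \<open>Y = X\<close>, so \<open>Y\<close> is empty and the sets \<open>P g\<close> cover
      \<open>X\<close>.\<close>
    moreover have "x \<notin> Y"
      using U(2) one_H[OF x] H.one_closed by (metis mem_Y)
    ultimately have cover: "X \<subseteq> \<Union>(P ` carrier H)"
      using x Y_def by blast
    have "compact X"
      using assms(1) by (simp add: rational_dynamical_system_def)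
    moreover have "\<forall>c\<in>P ` carrier H. openin (top_of_set X) c"
      using open_P by blast
    ultimately obtain D where "D \<subseteq> P ` carrier H" "finite D" "X \<subseteq> \<Union>D"
      unfolding compact_eq_openin_cover using cover by meson
    \<comment> \<open>One group element is chosen for each member of the finite subcover
      \<open>D\<close>.\<close>
    then obtain F where F: "F \<subseteq> carrier H" "finite F" "X \<subseteq> \<Union>(P ` F)"
      by (metis finite_subset_image)
    have "\<exists>g\<in>F. g \<otimes>\<^bsub>H\<^esub> S \<in> {S \<in> carrier H. S x \<in> V}" if S: "S \<in> carrier H" for S
    proof -
      \<comment> \<open>The cover is applied to the point \<open>S x\<close>, not to
        \<open>x\<close>, so a single finite \<open>F\<close> serves every \<open>S\<close>.\<close>
      obtain g where g: "g \<in> F" "g (S x) \<in> U"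
        using F(3) H_closed[OF S x] unfolding P_def by blast
      then have "g \<in> carrier H"
        using F(1) by blast
      then have "g \<otimes>\<^bsub>H\<^esub> S \<in> {S \<in> carrier H. S x \<in> V}"
        using g(2) S U(3) mult_H x by auto
      then show ?thesis
        using g(1) by blast
    qed
    moreover have "F \<noteq> {}"
      using F(3) x by auto
    ultimately show "syndetic (homeo_group X l T) {S \<in> carrier (homeo_group X l T). S x \<in> V}"
      unfolding syndetic_def H_def[symmetric] using F(1,2) by (intro conjI exI[of _ F]) auto
  qed
qed

end
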